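(* Let $\eta,\mu$ be real parameters, let $a<b$ and $T>0$. Let $u=u(x,t)$ and $q=q(x,t)$ be smooth real-valued functions, $x\in[a,b]$, $t\in[0,T]$, satisfying periodic boundary conditions in $x$, which solve the system $$u_t=\partial_x\left(-\frac{\eta}{6}q-\frac{\eta}{3}u^2-\mu^2u_{xx}\right),\qquad q_t=2u\,u_t .$$ Then the following conservation laws hold: $$\big(u(\cdot,t),1\big)=\big(u(\cdot,0),1\big)\quad\text{for all } t\in[0,T],$$ $$q(x,t)-\big(u(x,t)\big)^2=q(x,0)-\big(u(x,0)\big)^2\quad\text{for all } x\in[a,b],\ t\in[0,T],$$ $$\mathcal{E}(t)=\mathcal{E}(0)\quad\text{for all } t\in[0,T],$$ where $\mathcal{E}(t)=-\frac{\eta}{6}\big(u(\cdot,t),q(\cdot,t)\big)+\frac{\mu^2}{2}\|u_x(\cdot,t)\|^2$.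
   Context: $(f,g)=\int_a^b f g\,\mathrm{d}x$ denotes the $L^2([a,b])$ inner product and $\|f\|=\sqrt{(f,f)}$ the associated norm. "Periodic boundary conditions in $x$" means that $u(\cdot,t)$ and $q(\cdot,t)$ extend to smooth $(b-a)$-periodic functions of $x$ on $\mathbb{R}$. The displayed system is called the QAV (quadratic auxiliary variable) reformulation of the Korteweg-de Vries equation $u_t+\eta u u_x+\mu^2u_{xxx}=0$. *)

theory Defs
  imports "HOL-Analysis.Analysis"
begin

text \<open>
  Derivatives are taken within the set \<open>S\<close>, so on a nondegenerate closed interval or rectangle this is
  smoothness up to the boundary (one-sided derivatives there). On such sets, and on open sets, the
  derivative within \<open>S\<close> is unique, so the existential quantifier involves no choice.
\<close>

primrec Ck_on :: "nat \<Rightarrow> 'a::euclidean_space set \<Rightarrow> ('a \<Rightarrow> 'b::real_normed_vector) \<Rightarrow> bool" where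
  "Ck_on 0 S f \<longleftrightarrow> continuous_on S f"
| "Ck_on (Suc k) S f \<longleftrightarrow>
     (\<exists>f'. (\<forall>p\<in>S. (f has_derivative f' p) (at p within S)) \<and> (\<forall>v. Ck_on k S (\<lambda>p. f' p v)))"

definition smooth_on :: "'a::euclidean_space set \<Rightarrow> ('a \<Rightarrow> 'b::real_normed_vector) \<Rightarrow> bool" where
  "smooth_on S f \<longleftrightarrow> (\<forall>k. Ck_on k S f)"

definition periodic_bc :: "real \<Rightarrow> real \<Rightarrow> real \<Rightarrow> (real \<Rightarrow> real \<Rightarrow> real) \<Rightarrow> bool" where
  "periodic_bc a b T f \<longleftrightarrow>
     (\<forall>t\<in>{0..T}. \<exists>F :: real \<Rightarrow> real. smooth_on UNIV F \<and> (\<forall>x. F (x + (b - a)) = F x) \<and>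
        (\<forall>x\<in>{a..b}. F x = f x t))"

text \<open>
  Functions of \<open>(x, t)\<close> are only meaningful on \<open>[a,b] \<times> [0,T]\<close>; the partial derivatives are
  therefore taken within \<open>[a,b]\<close> and \<open>[0,T]\<close>, hence one-sided at the endpoints.
\<close>

definition partial_x :: "real \<Rightarrow> real \<Rightarrow> (real \<Rightarrow> real \<Rightarrow> real) \<Rightarrow> real \<Rightarrow> real \<Rightarrow> real" where
  "partial_x a b f x t = vector_derivative (\<lambda>y. f y t) (at x within {a..b})"

definition partial_t :: "real \<Rightarrow> (real \<Rightarrow> real \<Rightarrow> real) \<Rightarrow> real \<Rightarrow> real \<Rightarrow> real" where
  "partial_t T f x t = vector_derivative (\<lambda>s. f x s) (at t within {0..T})"

definition L2_inner :: "real \<Rightarrow> real \<Rightarrow> (real \<Rightarrow> real) \<Rightarrow> (real \<Rightarrow> real) \<Rightarrow> real" where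
  "L2_inner a b f g = integral {a..b} (\<lambda>x. f x * g x)"

definition L2_norm :: "real \<Rightarrow> real \<Rightarrow> (real \<Rightarrow> real) \<Rightarrow> real" where
  "L2_norm a b f = sqrt (L2_inner a b f f)"

definition QAV_KdV_solution ::
  "real \<Rightarrow> real \<Rightarrow> real \<Rightarrow> real \<Rightarrow> real \<Rightarrow> (real \<Rightarrow> real \<Rightarrow> real) \<Rightarrow> (real \<Rightarrow> real \<Rightarrow> real) \<Rightarrow> bool" where
  "QAV_KdV_solution a b T \<eta> \<mu> u q \<longleftrightarrow>
     (\<forall>x\<in>{a..b}. \<forall>t\<in>{0..T}.
        partial_t T u x t =
          partial_x a b
            (\<lambda>y s. - (\<eta> / 6) * q y s - (\<eta> / 3) * (u y s)\<^sup>2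
                   - \<mu>\<^sup>2 * partial_x a b (partial_x a b u) y s) x t \<and>
        partial_t T q x t = 2 * u x t * partial_t T u x t)"

definition QAV_energy ::
  "real \<Rightarrow> real \<Rightarrow> real \<Rightarrow> real \<Rightarrow> (real \<Rightarrow> real \<Rightarrow> real) \<Rightarrow> (real \<Rightarrow> real \<Rightarrow> real) \<Rightarrow> real \<Rightarrow> real" where
  "QAV_energy a b \<eta> \<mu> u q t =
     - (\<eta> / 6) * L2_inner a b (\<lambda>x. u x t) (\<lambda>x. q x t)
     + \<mu>\<^sup>2 / 2 * (L2_norm a b (\<lambda>x. partial_x a b u x t))\<^sup>2"

end

(*
  Along the flow put w = - (eta/6) q - (eta/3) u^2 - mu^2 u_xx, so that u_t = w_x.  Differentiating
  under the integral sign, using q_t = 2 u u_t and integrating u_x u_xt by parts, one finds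
  E'(t) = integral of w w_x plus mu^2 times the increment of u_x u_t from a to b, and both terms
  vanish by periodicity.  Exchanging the mixed derivatives u_xt = u_tx up to the boundary of the
  rectangle is justified by differentiating u(x,t) - u(x,0) = int_0^t u_t(x,s) ds in x.
*)
theory Submission
  imports Defs
begin

section \<open>Smoothness relative to a set and its derivatives\<close>

lemma Ck_on_cong: "(\<And>p. p \<in> S \<Longrightarrow> f p = g p) \<Longrightarrow> Ck_on k S f \<longleftrightarrow> Ck_on k S g"
proof (cases k)
  case 0
  then show "(\<And>p. p \<in> S \<Longrightarrow> f p = g p) \<Longrightarrow> ?thesis" by (simp cong: continuous_on_cong)
next
  case (Suc n)
  assume eq: "\<And>p. p \<in> S \<Longrightarrow> f p = g p"
  \<comment> \<open>No induction on \<open>k\<close> is needed: a derivative within \<open>S\<close>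
    at a point of \<open>S\<close> depends only on the values on \<open>S\<close>, so the same
    witness \<open>f'\<close> serves for both functions.\<close>
  then have "(f has_derivative f') (at p within S) \<longleftrightarrow> (g has_derivative f') (at p within S)"
    if "p \<in> S" for p f'
    using that eq by (metis has_derivative_transform)
  then show ?thesis using Suc by auto
qed

lemma smooth_on_cong: "(\<And>p. p \<in> S \<Longrightarrow> f p = g p) \<Longrightarrow> smooth_on S f \<longleftrightarrow> smooth_on S g"
  unfolding smooth_on_def by (simp cong: Ck_on_cong)

lemma smooth_on_imp_continuous_on: "smooth_on S f \<Longrightarrow> continuous_on S f"
  unfolding smooth_on_def by (metis Ck_on.simps(1))

text \<open>Smoothness provides, for every order \<open>k\<close>, a derivative that may depend on
  \<open>k\<close>. Uniqueness of the derivative within \<open>S\<close> makes all these choices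
  agree on \<open>S\<close>, so that a single \<open>f'\<close> has smooth directional derivatives
  of every order.\<close>

lemma smooth_on_derivative:
  assumes "smooth_on S f"
    and unique: "\<And>p f' f''. p \<in> S \<Longrightarrow> (f has_derivative f') (at p within S) \<Longrightarrow>
      (f has_derivative f'') (at p within S) \<Longrightarrow> f' = f''"
  obtains f' where "\<And>p. p \<in> S \<Longrightarrow> (f has_derivative f' p) (at p within S)"
    and "\<And>v. smooth_on S (\<lambda>p. f' p v)"
proof -
  have Ck: "Ck_on (Suc k) S f" for k
    using assms(1) by (simp add: smooth_on_def del: Ck_on.simps)
  obtain f' where f': "\<And>p. p \<in> S \<Longrightarrow> (f has_derivative f' p) (at p within S)"
    using Ck[of 0] by auto
  have "Ck_on k S (\<lambda>p. f' p v)" for k v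
  proof -
    obtain g where g: "\<And>p. p \<in> S \<Longrightarrow> (f has_derivative g p) (at p within S)"
      and Ckg: "Ck_on k S (\<lambda>p. g p v)"
      using Ck[of k] by auto
    have "g p = f' p" if "p \<in> S" for p
      using unique[OF that g f'] that by blast
    then show ?thesis
      using Ckg Ck_on_cong[of S "\<lambda>p. g p v" "\<lambda>p. f' p v" k] by simp
  qed
  with f' that show thesis
    unfolding smooth_on_def by blast
qed

section \<open>Periodic boundary values\<close>

lemma periodic_bc_endpoints: "a < b \<Longrightarrow> periodic_bc a b T f \<Longrightarrow> t \<in> {0..T} \<Longrightarrow> f a t = f b t"
  unfolding periodic_bc_def by (metis add.commute atLeastAtMost_iff diff_add_cancel less_imp_le order_refl)

text \<open>The derivative of a smooth periodic extension is again smooth and periodic, the latter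
  by differentiating F(x + (b - a)) = F(x). The lemma can be iterated, which gives matching endpoint
  values for u_x and u_xx.\<close>

lemma periodic_bc_partial_x:
  assumes "a < b" and "periodic_bc a b T f"
  shows "periodic_bc a b T (partial_x a b f)"
  unfolding periodic_bc_def
proof
  fix t assume "t \<in> {0..T}"
  then obtain F where F: "smooth_on UNIV F" "\<And>x. F (x + (b - a)) = F x"
      "\<And>x. x \<in> {a..b} \<Longrightarrow> F x = f x t"
    using assms(2) unfolding periodic_bc_def by blast
  obtain F' where F': "\<And>x. (F has_derivative F' x) (at x)"
    and smooth: "\<And>v. smooth_on UNIV (\<lambda>x. F' x v)"
    using smooth_on_derivative[OF F(1)] has_derivative_unique by (metis UNIV_I)
  have vd: "(F has_vector_derivative F' x 1) (at x)" for x
    using vector_derivative_diff_chain_within[OF has_vector_derivative_id, of F "F' x" x UNIV] F'[of x]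
    by (simp add: o_def)
  have "F' (x + (b - a)) 1 = F' x 1" for x
  proof -
    have "((\<lambda>y. F (y + (b - a))) has_vector_derivative F' (x + (b - a)) 1) (at x)"
      using vd[of "x + (b - a)"]
      by (simp add: has_real_derivative_iff_has_vector_derivative[symmetric] DERIV_shift)
    then show ?thesis
      using vd[of x] by (simp add: F(2) vector_derivative_unique_at)
  qed
  \<comment> \<open>At the endpoints the one-sided derivative of \<open>f\<close> equals the
    two-sided derivative of \<open>F\<close>, since both functions agree on the nondegenerate
    interval.\<close>
  moreover have "F' x 1 = partial_x a b f x t" if "x \<in> {a..b}" for x
  proof -
    have "((\<lambda>y. f y t) has_vector_derivative F' x 1) (at x within {a..b})"
      by (rule has_vector_derivative_transform[OF that _ has_vector_derivative_at_within[OF vd]])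
        (simp add: F(3))
    then show ?thesis
      unfolding partial_x_def using assms(1) that by (simp add: vector_derivative_within_closed_interval)
  qed
  ultimately show "\<exists>G. smooth_on UNIV G \<and> (\<forall>x. G (x + (b - a)) = G x)
      \<and> (\<forall>x\<in>{a..b}. G x = partial_x a b f x t)"
    using smooth by blast
qed

section \<open>Partial derivatives on the closed rectangle\<close>

lemma smooth_on_rectangle_partials:
  fixes f :: "real \<Rightarrow> real \<Rightarrow> real"
  assumes ab: "a < b" and T: "0 < T"
    and smooth: "smooth_on ({a..b} \<times> {0..T}) (\<lambda>(x, t). f x t)"
  shows "smooth_on ({a..b} \<times> {0..T}) (\<lambda>(x, t). partial_x a b f x t)"
    and "smooth_on ({a..b} \<times> {0..T}) (\<lambda>(x, t). partial_t T f x t)"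
    and "\<And>x t. x \<in> {a..b} \<Longrightarrow> t \<in> {0..T} \<Longrightarrow>
      ((\<lambda>y. f y t) has_real_derivative partial_x a b f x t) (at x within {a..b})"
    and "\<And>x t. x \<in> {a..b} \<Longrightarrow> t \<in> {0..T} \<Longrightarrow>
      ((\<lambda>s. f x s) has_real_derivative partial_t T f x t) (at t within {0..T})"
proof -
  let ?S = "{a..b} \<times> {0..T}"
  have S: "?S = cbox (a, 0) (b, T)"
    by (simp add: cbox_Pair_eq)
  \<comment> \<open>The strict inequalities \<open>a < b\<close> and \<open>0 < T\<close> give the
    box positive length in both directions, which forces uniqueness even at edges and
    corners.\<close>
  have "g' = g''" if "p \<in> ?S" "((\<lambda>(x, t). f x t) has_derivative g') (at p within ?S)"
    "((\<lambda>(x, t). f x t) has_derivative g'') (at p within ?S)" for p g' g''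
    by (rule frechet_derivative_unique_within_closed_interval[OF _ that[unfolded S]])
      (use ab T in \<open>auto simp: Basis_prod_def\<close>)
  then obtain f' where f': "\<And>p. p \<in> ?S \<Longrightarrow> ((\<lambda>(x, t). f x t) has_derivative f' p) (at p within ?S)"
    and smooth': "\<And>v. smooth_on ?S (\<lambda>p. f' p v)"
    using smooth_on_derivative[OF smooth] by metis
  \<comment> \<open>The partial derivatives are the total derivative applied to (1, 0) and (0, 1),
    by the chain rule along horizontal and vertical segments inside the rectangle. Hence they are
    smooth too, and the lemma applies to them in turn.\<close>
  have x: "((\<lambda>y. f y t) has_vector_derivative f' (x, t) (1, 0)) (at x within {a..b})"
    if xt: "x \<in> {a..b}" "t \<in> {0..T}" for x t
  proof -
    have "((\<lambda>y. (y, t)) has_vector_derivative (1, 0)) (at x within {a..b})"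
      unfolding has_vector_derivative_def by (auto intro!: derivative_eq_intros)
    moreover have "((\<lambda>(x, t). f x t) has_derivative f' (x, t)) (at (x, t) within (\<lambda>y. (y, t)) ` {a..b})"
      by (rule has_derivative_subset[OF f']) (use xt in auto)
    ultimately show ?thesis
      using vector_derivative_diff_chain_within by (fastforce simp: o_def)
  qed
  have t: "((\<lambda>s. f x s) has_vector_derivative f' (x, t) (0, 1)) (at t within {0..T})"
    if xt: "x \<in> {a..b}" "t \<in> {0..T}" for x t
  proof -
    have "((\<lambda>s. (x, s)) has_vector_derivative (0, 1)) (at t within {0..T})"
      unfolding has_vector_derivative_def by (auto intro!: derivative_eq_intros)
    moreover have "((\<lambda>(x, t). f x t) has_derivative f' (x, t)) (at (x, t) within (\<lambda>s. (x, s)) ` {0..T})"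
      by (rule has_derivative_subset[OF f']) (use xt in auto)
    ultimately show ?thesis
      using vector_derivative_diff_chain_within by (fastforce simp: o_def)
  qed
  have x_eq: "partial_x a b f x t = f' (x, t) (1, 0)" if "x \<in> {a..b}" "t \<in> {0..T}" for x t
    unfolding partial_x_def by (rule vector_derivative_within_closed_interval[OF ab that(1) x[OF that]])
  have t_eq: "partial_t T f x t = f' (x, t) (0, 1)" if "x \<in> {a..b}" "t \<in> {0..T}" for x t
    unfolding partial_t_def by (rule vector_derivative_within_closed_interval[OF T that(2) t[OF that]])
  show "smooth_on ?S (\<lambda>(x, t). partial_x a b f x t)"
    using smooth'[of "(1, 0)"] by (rule smooth_on_cong[THEN iffD1, rotated]) (auto simp: x_eq)
  show "smooth_on ?S (\<lambda>(x, t). partial_t T f x t)"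
    using smooth'[of "(0, 1)"] by (rule smooth_on_cong[THEN iffD1, rotated]) (auto simp: t_eq)
  show "((\<lambda>y. f y t) has_real_derivative partial_x a b f x t) (at x within {a..b})"
    if "x \<in> {a..b}" "t \<in> {0..T}" for x t
    using x[OF that] by (simp add: x_eq[OF that] has_real_derivative_iff_has_vector_derivative)
  show "((\<lambda>s. f x s) has_real_derivative partial_t T f x t) (at t within {0..T})"
    if "x \<in> {a..b}" "t \<in> {0..T}" for x t
    using t[OF that] by (simp add: t_eq[OF that] has_real_derivative_iff_has_vector_derivative)
qed

section \<open>Parameter integrals and mixed derivatives\<close>

lemma continuous_on_rectangle_slice_x:
  assumes "continuous_on (A \<times> B) (\<lambda>(x, t). f x t)" and "t \<in> B"
  shows "continuous_on A (\<lambda>x. f x t)"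
proof -
  have "continuous_on A (\<lambda>x. (\<lambda>(x, t). f x t) (x, t))"
    by (rule continuous_on_compose2[OF assms(1)]) (use assms(2) in \<open>auto intro!: continuous_intros\<close>)
  then show ?thesis by simp
qed

text \<open>The Leibniz rule expects the parameter as first coordinate, whereas here the space
  variable comes first.\<close>

lemma continuous_on_rectangle_swap:
  assumes "continuous_on (A \<times> B) (\<lambda>(x, t). f x t)"
  shows "continuous_on (B \<times> A) (\<lambda>(t, x). f x t)"
proof -
  have "continuous_on (B \<times> A) (\<lambda>p. (\<lambda>(x, t). f x t) (snd p, fst p))"
    by (rule continuous_on_compose2[OF assms]) (auto intro!: continuous_intros)
  then show ?thesis by (simp add: split_beta)
qed

lemma integral_has_derivative_t:
  fixes f :: "real \<Rightarrow> real \<Rightarrow> real"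
  assumes "continuous_on ({a..b} \<times> {c..d}) (\<lambda>(x, t). f x t)"
    and ft: "continuous_on ({a..b} \<times> {c..d}) (\<lambda>(x, t). ft x t)"
    and deriv: "\<And>x t. x \<in> {a..b} \<Longrightarrow> t \<in> {c..d} \<Longrightarrow>
      ((\<lambda>s. f x s) has_real_derivative ft x t) (at t within {c..d})"
    and "t \<in> {c..d}"
  shows "((\<lambda>s. integral {a..b} (\<lambda>x. f x s)) has_real_derivative integral {a..b} (\<lambda>x. ft x t))
    (at t within {c..d})"
proof -
  have "(\<lambda>x. f x s) integrable_on {a..b}" if "s \<in> {c..d}" for s
    by (rule integrable_continuous_real[OF continuous_on_rectangle_slice_x[OF assms(1) that]])
  then show ?thesis
    using leibniz_rule_field_derivative[of "{c..d}" a b "\<lambda>t x. f x t" "\<lambda>t x. ft x t" t]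
      continuous_on_rectangle_swap[OF ft] deriv assms(4)
    by simp
qed

lemma partial_t_partial_x:
  fixes f :: "real \<Rightarrow> real \<Rightarrow> real"
  assumes ab: "a < b" and T: "0 < T"
    and smooth: "smooth_on ({a..b} \<times> {0..T}) (\<lambda>(x, t). f x t)"
    and xt: "x \<in> {a..b}" "t \<in> {0..T}"
  shows "((\<lambda>s. partial_x a b f x s) has_real_derivative partial_x a b (partial_t T f) x t)
    (at t within {0..T})"
proof -
  let ?ft = "partial_t T f"
  note f = smooth_on_rectangle_partials[OF ab T smooth]
  note ft = smooth_on_rectangle_partials[OF ab T f(2)]
  have cont_ft: "continuous_on ({0..T} \<times> {a..b}) (\<lambda>(s, y). ?ft y s)"
    by (rule continuous_on_rectangle_swap[OF smooth_on_imp_continuous_on[OF f(2)]])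
  have cont_ftx: "continuous_on ({0..T} \<times> {a..b}) (\<lambda>(s, y). partial_x a b ?ft y s)"
    by (rule continuous_on_rectangle_swap[OF smooth_on_imp_continuous_on[OF ft(1)]])
  have eq: "partial_x a b f x \<tau> = partial_x a b f x 0 + integral {0..\<tau>} (\<lambda>s. partial_x a b ?ft x s)"
    if \<tau>: "\<tau> \<in> {0..T}" for \<tau>
  proof -
    have FTC: "f y \<tau> = f y 0 + integral {0..\<tau>} (\<lambda>s. ?ft y s)" if y: "y \<in> {a..b}" for y
    proof -
      have "((\<lambda>s. ?ft y s) has_integral f y \<tau> - f y 0) {0..\<tau>}"
      proof (rule fundamental_theorem_of_calculus)
        show "(f y has_vector_derivative ?ft y s) (at s within {0..\<tau>})" if "s \<in> {0..\<tau>}" for s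
          using f(4)[OF y, of s] that \<tau>
          by (auto simp: has_real_derivative_iff_has_vector_derivative
              intro: has_vector_derivative_within_subset)
      qed (use \<tau> in auto)
      then show ?thesis by (simp add: integral_unique)
    qed
    \<comment> \<open>Here time is the integration variable and x the parameter, the reverse of the
      use for the conserved quantities; this is why the swapped continuity facts are needed.\<close>
    have "((\<lambda>y. integral {0..\<tau>} (\<lambda>s. ?ft y s)) has_real_derivative
        integral {0..\<tau>} (\<lambda>s. partial_x a b ?ft x s)) (at x within {a..b})"
      by (rule integral_has_derivative_t)
        (use \<tau> xt ft(3) in \<open>auto intro!: continuous_on_subset[OF cont_ft] continuous_on_subset[OF cont_ftx]\<close>)
    from DERIV_add[OF f(3)[OF xt(1), of 0] this]
    have "((\<lambda>y. f y 0 + integral {0..\<tau>} (\<lambda>s. ?ft y s)) has_real_derivative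
        partial_x a b f x 0 + integral {0..\<tau>} (\<lambda>s. partial_x a b ?ft x s)) (at x within {a..b})"
      using T by simp
    then have "((\<lambda>y. f y \<tau>) has_vector_derivative
        partial_x a b f x 0 + integral {0..\<tau>} (\<lambda>s. partial_x a b ?ft x s)) (at x within {a..b})"
      unfolding has_real_derivative_iff_has_vector_derivative
      by (rule has_vector_derivative_transform[OF xt(1), rotated]) (rule FTC)
    then show ?thesis
      unfolding partial_x_def[of a b f x \<tau>]
      by (rule vector_derivative_within_closed_interval[OF ab xt(1)])
  qed
  \<comment> \<open>Since \<open>eq\<close> holds on all of [0,T], differentiating its right-hand
    side in the upper limit gives the claim; this takes only continuity of the integrand in
    time.\<close>
  have "continuous_on {0..T} (\<lambda>s. partial_x a b ?ft x s)"
    using continuous_on_rectangle_slice_x[OF cont_ftx xt(1)] .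
  from DERIV_add[OF DERIV_const integral_has_real_derivative[OF this xt(2)]]
  have "((\<lambda>\<tau>. partial_x a b f x 0 + integral {0..\<tau>} (\<lambda>s. partial_x a b ?ft x s))
      has_real_derivative partial_x a b ?ft x t) (at t within {0..T})"
    by simp
  then show ?thesis
    unfolding has_real_derivative_iff_has_vector_derivative
    by (rule has_vector_derivative_transform[OF xt(2), rotated]) (rule eq)
qed

section \<open>The three conservation laws\<close>

lemma DERIV_zero_imp_eq_initial:
  fixes f :: "real \<Rightarrow> real"
  assumes "\<And>s. s \<in> {0..T} \<Longrightarrow> (f has_real_derivative 0) (at s within {0..T})" and "t \<in> {0..T}"
  shows "f t = f 0"
  using has_field_derivative_zero_constant[of "{0..T}" f] assms by fastforce

theorem theorem2p1:
  fixes \<eta> \<mu> a b T :: real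
    and u q :: "real \<Rightarrow> real \<Rightarrow> real"
  assumes "a < b" and "0 < T"
    and "smooth_on ({a..b} \<times> {0..T}) (\<lambda>(x, t). u x t)"
    and "smooth_on ({a..b} \<times> {0..T}) (\<lambda>(x, t). q x t)"
    and "periodic_bc a b T u"
    and "periodic_bc a b T q"
    and "QAV_KdV_solution a b T \<eta> \<mu> u q"
  shows "(\<forall>t\<in>{0..T}. L2_inner a b (\<lambda>x. u x t) (\<lambda>x. 1) = L2_inner a b (\<lambda>x. u x 0) (\<lambda>x. 1))
    \<and> (\<forall>x\<in>{a..b}. \<forall>t\<in>{0..T}. q x t - (u x t)\<^sup>2 = q x 0 - (u x 0)\<^sup>2)
    \<and> (\<forall>t\<in>{0..T}. QAV_energy a b \<eta> \<mu> u q t = QAV_energy a b \<eta> \<mu> u q 0)"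
proof (intro conjI ballI)
  note ab = assms(1) and T = assms(2)
  let ?S = "{a..b} \<times> {0..T}"
  define ux where "ux = partial_x a b u"
  define uxx where "uxx = partial_x a b ux"
  define ut where "ut = partial_t T u"
  define utx where "utx = partial_x a b ut"
  define w where "w = (\<lambda>y s. - (\<eta> / 6) * q y s - (\<eta> / 3) * (u y s)\<^sup>2 - \<mu>\<^sup>2 * uxx y s)"
  note u = smooth_on_rectangle_partials[OF ab T assms(3), folded ux_def ut_def]
  note q = smooth_on_rectangle_partials[OF ab T assms(4)]
  note ux = smooth_on_rectangle_partials[OF ab T u(1), folded uxx_def]
  note uxx = smooth_on_rectangle_partials[OF ab T ux(1)]
  note ut = smooth_on_rectangle_partials[OF ab T u(2), folded utx_def]
  note uxt = partial_t_partial_x[OF ab T assms(3), folded ux_def ut_def, folded utx_def]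
  note cont = assms(3,4)[THEN smooth_on_imp_continuous_on] u(1,2)[THEN smooth_on_imp_continuous_on]
    ux(1)[THEN smooth_on_imp_continuous_on] ut(1)[THEN smooth_on_imp_continuous_on]
  note [continuous_intros] = cont[unfolded split_beta]

  have w_deriv: "((\<lambda>y. w y t) has_real_derivative ut x t) (at x within {a..b})"
    and qt: "partial_t T q x t = 2 * u x t * ut x t" if xt: "x \<in> {a..b}" "t \<in> {0..T}" for x t
  proof -
    have *: "ut x t = partial_x a b w x t" "partial_t T q x t = 2 * u x t * ut x t"
      using assms(7) xt unfolding QAV_KdV_solution_def ut_def w_def uxx_def ux_def by blast+
    show "partial_t T q x t = 2 * u x t * ut x t" by (rule *)
    \<comment> \<open>\<open>partial_x\<close> is built on a choice operator, so the equation by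
      itself does not say that w is differentiable in x. Differentiability comes from smoothness of
      u, q and u_xx; uniqueness then identifies \<open>D\<close> with u_t.\<close>
    have "\<exists>D. ((\<lambda>y. w y t) has_real_derivative D) (at x within {a..b})"
      unfolding w_def
      by (rule exI, (rule derivative_eq_intros u(3)[OF xt] q(3)[OF xt] uxx(3)[OF xt] refl)+)
    then obtain D where D: "((\<lambda>y. w y t) has_real_derivative D) (at x within {a..b})" ..
    then have "partial_x a b w x t = D"
      unfolding partial_x_def has_real_derivative_iff_has_vector_derivative
      by (rule vector_derivative_within_closed_interval[OF ab xt(1)])
    then show "((\<lambda>y. w y t) has_real_derivative ut x t) (at x within {a..b})"
      using D * by simp
  qed

  \<comment> \<open>The endpoint values of w involve u_xx, hence two applications of
    \<open>periodic_bc_partial_x\<close>.\<close>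
  have u_end: "u a s = u b s" and w_end: "w a s = w b s" and ux_end: "ux a s = ux b s"
    if "s \<in> {0..T}" for s
    using that periodic_bc_endpoints[OF ab] assms(5,6) periodic_bc_partial_x[OF ab]
    unfolding w_def uxx_def ux_def by metis+
  \<comment> \<open>The boundary condition is imposed at each fixed time and says nothing directly
    about u_t. But u(a,s) and u(b,s) are the same function of s on [0,T], so their time derivatives
    coincide.\<close>
  have ut_end: "ut a s = ut b s" if "s \<in> {0..T}" for s
  proof -
    have "((\<lambda>s. u b s) has_real_derivative ut a s) (at s within {0..T})"
      unfolding has_real_derivative_iff_has_vector_derivative
      by (rule has_vector_derivative_transform[OF that,
            OF _ u(4)[of a, unfolded has_real_derivative_iff_has_vector_derivative]])
        (use ab that u_end in auto)
    then show ?thesis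
      using vector_derivative_within_closed_interval[OF T that]
      unfolding has_real_derivative_iff_has_vector_derivative
      by (metis partial_t_def ut_def)
  qed

  show "q x t - (u x t)\<^sup>2 = q x 0 - (u x 0)\<^sup>2" if x: "x \<in> {a..b}" and t: "t \<in> {0..T}" for x t
  proof (rule DERIV_zero_imp_eq_initial[OF _ t])
    fix s assume s: "s \<in> {0..T}"
    show "((\<lambda>s. q x s - (u x s)\<^sup>2) has_real_derivative 0) (at s within {0..T})"
      by (rule derivative_eq_intros u(4)[OF x s] q(4)[OF x s] refl)+ (simp add: qt[OF x s])
  qed

  show "L2_inner a b (\<lambda>x. u x t) (\<lambda>x. 1) = L2_inner a b (\<lambda>x. u x 0) (\<lambda>x. 1)"
    if t: "t \<in> {0..T}" for t
  proof (rule DERIV_zero_imp_eq_initial[OF _ t])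
    fix s assume s: "s \<in> {0..T}"
    \<comment> \<open>The equation makes w( . , s) a primitive of u_t( . , s).\<close>
    have "((\<lambda>x. ut x s) has_integral w b s - w a s) {a..b}"
      by (rule fundamental_theorem_of_calculus)
        (use ab w_deriv s in \<open>auto simp: has_real_derivative_iff_has_vector_derivative\<close>)
    then have "integral {a..b} (\<lambda>x. ut x s) = 0"
      by (simp add: w_end[OF s] integral_unique)
    with integral_has_derivative_t[OF cont(1) cont(4) u(4) s]
    show "((\<lambda>s. L2_inner a b (\<lambda>x. u x s) (\<lambda>x. 1)) has_real_derivative 0) (at s within {0..T})"
      by (simp add: L2_inner_def)
  qed

  show "QAV_energy a b \<eta> \<mu> u q t = QAV_energy a b \<eta> \<mu> u q 0" if t: "t \<in> {0..T}" for t
  proof -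
    let ?e = "\<lambda>x s. - (\<eta> / 6) * (u x s * q x s) + \<mu>\<^sup>2 / 2 * (ux x s * ux x s)"
    \<comment> \<open>The time derivative of the density \<open>?e\<close>, with q_t already
      replaced by 2 u u_t and the mixed derivative written as u_tx.\<close>
    let ?et = "\<lambda>x s. - (\<eta> / 6) * (ut x s * q x s + u x s * (2 * u x s * ut x s))
        + \<mu>\<^sup>2 * (ux x s * utx x s)"
    have energy: "QAV_energy a b \<eta> \<mu> u q s = integral {a..b} (\<lambda>x. ?e x s)" if s: "s \<in> {0..T}" for s
    proof -
      note [continuous_intros] = cont[THEN continuous_on_rectangle_slice_x, OF s]
      have int: "(\<lambda>x. u x s * q x s) integrable_on {a..b}" "(\<lambda>x. ux x s * ux x s) integrable_on {a..b}"
        by (auto intro!: integrable_continuous_real continuous_intros)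
      have "integral {a..b} (\<lambda>x. ?e x s) = - (\<eta> / 6) * integral {a..b} (\<lambda>x. u x s * q x s)
          + \<mu>\<^sup>2 / 2 * integral {a..b} (\<lambda>x. ux x s * ux x s)"
        unfolding integral_mult_right[symmetric]
        by (rule integral_add) (intro integrable_continuous_real continuous_intros)+
      \<comment> \<open>Nonnegativity lets the square cancel the square root in
        \<open>L2_norm\<close>.\<close>
      moreover have "0 \<le> integral {a..b} (\<lambda>x. ux x s * ux x s)"
        by (rule integral_nonneg) (use int in auto)
      ultimately show ?thesis
        unfolding QAV_energy_def L2_norm_def L2_inner_def ux_def[symmetric] by simp
    qed
    have "integral {a..b} (\<lambda>x. ?e x t) = integral {a..b} (\<lambda>x. ?e x 0)"
    proof (rule DERIV_zero_imp_eq_initial[OF _ t])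
      fix s assume s: "s \<in> {0..T}"
      \<comment> \<open>The primitive comes from - (eta/6) q - (eta/3) u^2 = w + mu^2 u_xx: the
        integrand becomes u_t (w + mu^2 u_xx) + mu^2 u_x u_tx. With u_t = w_x this is w w_x + mu^2
        (u_x u_t)_x.\<close>
      have "((\<lambda>x. ?et x s) has_integral
          (1 / 2 * (w b s)\<^sup>2 + \<mu>\<^sup>2 * (ux b s * ut b s)) - (1 / 2 * (w a s)\<^sup>2 + \<mu>\<^sup>2 * (ux a s * ut a s))) {a..b}"
      proof (rule fundamental_theorem_of_calculus)
        fix x assume x: "x \<in> {a..b}"
        have "((\<lambda>x. 1 / 2 * (w x s)\<^sup>2 + \<mu>\<^sup>2 * (ux x s * ut x s)) has_real_derivative ?et x s)
            (at x within {a..b})"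
          by (rule derivative_eq_intros w_deriv[OF x s] ux(3)[OF x s] ut(3)[OF x s] refl)+
            (simp add: w_def field_simps power2_eq_square)
        then show "((\<lambda>x. 1 / 2 * (w x s)\<^sup>2 + \<mu>\<^sup>2 * (ux x s * ut x s)) has_vector_derivative ?et x s)
            (at x within {a..b})"
          by (simp add: has_real_derivative_iff_has_vector_derivative)
      qed (use ab in simp)
      then have "integral {a..b} (\<lambda>x. ?et x s) = 0"
        by (simp add: w_end[OF s] ux_end[OF s] ut_end[OF s] integral_unique)
      moreover have "((\<lambda>s. integral {a..b} (\<lambda>x. ?e x s)) has_real_derivative
          integral {a..b} (\<lambda>x. ?et x s)) (at s within {0..T})"
      proof (rule integral_has_derivative_t[OF _ _ _ s])
        show "continuous_on ?S (\<lambda>(x, t). ?e x t)" "continuous_on ?S (\<lambda>(x, t). ?et x t)"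
          unfolding split_beta by (intro continuous_intros)+
        fix x r assume xr: "x \<in> {a..b}" "r \<in> {0..T}"
        \<comment> \<open>The exchange \<open>uxt\<close> enters here: the time derivative of u_x
          becomes u_tx, the form that the spatial primitive produces.\<close>
        show "((\<lambda>r. ?e x r) has_real_derivative ?et x r) (at r within {0..T})"
          by (rule derivative_eq_intros u(4)[OF xr] q(4)[OF xr] uxt[OF xr] refl)+
            (simp add: qt[OF xr] algebra_simps)
      qed
      ultimately show "((\<lambda>s. integral {a..b} (\<lambda>x. ?e x s)) has_real_derivative 0)
          (at s within {0..T})"
        by simp
    qed
    then show ?thesis
      using energy t T by simp
  qed
qed

end
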